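(* Let $\mathcal{H}$ be a separable Hilbert space, $I$ a countable index set, and let $\varphi=\{\varphi_i\}_{i\in I}$ and $\psi=\{\psi_i\}_{i\in I}$ be two frames for $\mathcal{H}$ with frame bounds $A_\varphi,B_\varphi$ and $A_\psi,B_\psi$, respectively. Suppose there are positive numbers $\lambda_1,\lambda_2,\mu$ such that for all scalar sequences $\{c_i\}_{i\in I}\in\ell^2(I)$ $$\left\Vert\sum_{i\in I}c_i(\varphi_i-\psi_i)\right\Vert\le\lambda_1\left\Vert\sum_{i\in I}c_i\varphi_i\right\Vert+\lambda_2\left\Vert\sum_{i\in I}c_i\psi_i\right\Vert+\mu\left(\sum_{i\in I}|c_i|^2\right)^{1/2},$$ and $$\lambda_1\sqrt{B_\varphi}+\lambda_2\sqrt{B_\psi}+\mu<\sqrt{A_\varphi}.$$ Then $\varphi$ and $\psi$ are woven.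
   Context: A family $\{\varphi_i\}_{i\in I}$ in $\mathcal{H}$ is a frame for $\mathcal{H}$ with frame bounds $0<A_\varphi\le B_\varphi<\infty$ if $A_\varphi\Vert f\Vert^2\le\sum_{i\in I}|\langle f,\varphi_i\rangle|^2\le B_\varphi\Vert f\Vert^2$ for all $f\in\mathcal{H}$. Two frames $\{\varphi_i\}_{i\in I}$ and $\{\psi_i\}_{i\in I}$ are woven if there are constants $0<A\le B<\infty$ such that for every $J\subseteq I$ the family $\{\varphi_i\}_{i\in J}\cup\{\psi_i\}_{i\in J^c}$ (with $J^c=I\setminus J$, counted with indices) is a frame for $\mathcal{H}$ with bounds $A$ and $B$. *)

theory Defs
  imports "HOL-Analysis.Analysis"
begin

text \<open>
  A common treatment of the scalar fields of the reals and of the complex numbers. By the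
  Gelfand-Mazur theorem every \<^class>\<open>real_normed_field\<close> is isometrically isomorphic to one of
  these two, and the last axiom then forces \<open>conj\<close> to be the usual conjugation.
\<close>

class real_or_complex = real_normed_field +
  fixes conj :: "'a \<Rightarrow> 'a"
  assumes conj_add: "conj (x + y) = conj x + conj y"
    and conj_mult: "conj (x * y) = conj x * conj y"
    and conj_conj: "conj (conj x) = x"
    and mult_conj: "x * conj x = ((norm x)\<^sup>2) *\<^sub>R 1"

instantiation real :: real_or_complex
begin
definition conj_real :: "real \<Rightarrow> real" where "conj_real x = x"
instance by standard (simp_all add: conj_real_def power2_eq_square)
end

instantiation complex :: real_or_complex
begin
definition conj_complex :: "complex \<Rightarrow> complex" where "conj_complex = cnj"
instance by standard (simp_all add: conj_complex_def scaleR_conv_of_real complex_norm_square del: of_real_power)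
end

text \<open>
  Hilbert spaces over such a field: completeness is part of the sort \<^class>\<open>banach\<close>, and
  \<open>ip_self\<close> says that the norm of the type is the one induced by the inner product. The inner
  product is linear in its first argument.
\<close>

locale hilbert_space = vector_space scale
  for scale :: "'k::real_or_complex \<Rightarrow> 'a::banach \<Rightarrow> 'a" +
  fixes ip :: "'a \<Rightarrow> 'a \<Rightarrow> 'k"
  assumes scale_of_real: "scale (of_real r) x = r *\<^sub>R x"
    and ip_add_left: "ip (x + y) z = ip x z + ip y z"
    and ip_scale_left: "ip (scale c x) y = c * ip x y"
    and ip_commute: "ip y x = conj (ip x y)"
    and ip_self: "ip x x = of_real ((norm x)\<^sup>2)"

lemma hilbert_space_real:
  "hilbert_space (scaleR :: real \<Rightarrow> 'a \<Rightarrow> 'a::{real_inner, banach}) inner"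
  by unfold_locales
    (simp_all add: algebra_simps conj_real_def inner_commute power2_norm_eq_inner)

lemma hilbert_space_complex:
  "hilbert_space (\<lambda>c x :: complex. c * x) (\<lambda>x y. x * cnj y)"
  by unfold_locales
    (simp_all add: algebra_simps conj_complex_def complex_norm_square scaleR_conv_of_real
      del: of_real_power)

text \<open>
  The summability clause expresses that the sum of squares is finite; \<^const>\<open>infsum\<close> is 0 by
  convention when it is not.
\<close>

definition frame_with_bounds ::
    "('a::real_normed_vector \<Rightarrow> 'a \<Rightarrow> 'k::real_normed_field) \<Rightarrow> 'i set \<Rightarrow> ('i \<Rightarrow> 'a)
      \<Rightarrow> real \<Rightarrow> real \<Rightarrow> bool" where
  "frame_with_bounds ip I \<phi> A B \<longleftrightarrow>
     0 < A \<and> A \<le> B \<and>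
     (\<forall>f. (\<lambda>i. (norm (ip f (\<phi> i)))\<^sup>2) summable_on I \<and>
          A * (norm f)\<^sup>2 \<le> (\<Sum>\<^sub>\<infinity>i\<in>I. (norm (ip f (\<phi> i)))\<^sup>2) \<and>
          (\<Sum>\<^sub>\<infinity>i\<in>I. (norm (ip f (\<phi> i)))\<^sup>2) \<le> B * (norm f)\<^sup>2)"

definition woven ::
    "('a::real_normed_vector \<Rightarrow> 'a \<Rightarrow> 'k::real_normed_field) \<Rightarrow> 'i set \<Rightarrow> ('i \<Rightarrow> 'a)
      \<Rightarrow> ('i \<Rightarrow> 'a) \<Rightarrow> bool" where
  "woven ip I \<phi> \<psi> \<longleftrightarrow>
     (\<exists>A B. 0 < A \<and> A \<le> B \<and>
        (\<forall>J\<subseteq>I. frame_with_bounds ip I (\<lambda>i. if i \<in> J then \<phi> i else \<psi> i) A B))"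

definition ell2 :: "'i set \<Rightarrow> ('i \<Rightarrow> 'k::real_normed_field) set" where
  "ell2 I = {c. (\<lambda>i. (norm (c i))\<^sup>2) summable_on I}"

end

theory Submission
  imports Defs
begin

text \<open>
  Tested on finitely supported sequences, the perturbation hypothesis says that the synthesis
  operator of \<open>\<phi> - \<psi>\<close> has norm at most
  \<open>D = lam\<^sub>1 * sqrt B\<^sub>\<phi> + lam\<^sub>2 * sqrt B\<^sub>\<psi> + \<mu>\<close>; by duality so has its
  analysis operator. Replacing \<open>\<phi> i\<close> by \<open>\<psi> i\<close> for \<open>i \<notin> J\<close> therefore moves the analysis sequence
  of \<open>f\<close> by at most \<open>D * norm f\<close> in the \<open>\<ell>\<^sup>2\<close> norm, which leaves the lower bound
  \<open>(sqrt A\<^sub>\<phi> - D)\<^sup>2\<close>, uniformly in \<open>J\<close>.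
\<close>

lemma conj_zero [simp]: "conj (0::'k::real_or_complex) = 0"
  using conj_add[of 0 "0::'k"] by simp

text \<open>The axioms do not say that \<open>conj\<close> is isometric; it follows from
  \<open>mult_conj\<close> by taking norms and cancelling \<open>norm x\<close>. That
  \<open>conj\<close> fixes the reals comes from the same axiom by cancelling
  \<open>of_real r\<close>.\<close>

lemma norm_conj [simp]: "norm (conj x) = norm (x::'k::real_or_complex)"
proof (cases "x = 0")
  case False
  have "norm x * norm (conj x) = norm x * norm x"
    using mult_conj[of x] by (simp flip: norm_mult add: power2_eq_square)
  with False show ?thesis by simp
qed simp

lemma conj_of_real [simp]: "conj (of_real r) = (of_real r :: 'k::real_or_complex)"
proof (cases "r = 0")
  case False
  have "of_real r * conj (of_real r) = (of_real r * of_real r :: 'k)"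
    using mult_conj[of "of_real r :: 'k"] by (simp add: scaleR_conv_of_real power2_eq_square)
  with False show ?thesis by simp
qed simp

lemma mult_conj_of_real: "x * conj x = (of_real ((norm x)\<^sup>2) :: 'k::real_or_complex)"
  using mult_conj[of x] by (simp add: scaleR_conv_of_real)

context hilbert_space
begin

lemma ip_diff_left: "ip (x - y) z = ip x z - ip y z"
  using ip_add_left[of "x - y" y z] by (simp add: algebra_simps)

lemma ip_add_right: "ip x (y + z) = ip x y + ip x z"
  by (metis ip_commute ip_add_left conj_add)

lemma ip_diff_right: "ip x (y - z) = ip x y - ip x z"
  using ip_add_right[of x "y - z" z] by (simp add: algebra_simps)

lemma ip_scale_right: "ip x (scale c y) = conj c * ip x y"
  by (metis ip_commute ip_scale_left conj_mult)

lemma ip_zero_right [simp]: "ip x 0 = 0"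
  using ip_diff_right[of x 0 0] by simp

lemma ip_sum_right: "ip x (sum g F) = (\<Sum>i\<in>F. ip x (g i))"
  by (induction F rule: infinite_finite_induct) (auto simp: ip_add_right)

lemma ip_Cauchy_Schwarz: "norm (ip x y) \<le> norm x * norm y"
proof (cases "y = 0")
  case False
  define a where "a = ip x y"
  define b where "b = (norm y)\<^sup>2"
  \<comment> \<open>\<open>z\<close> is \<open>(norm y)\<^sup>2\<close> times the component of
    \<open>x\<close> orthogonal to \<open>y\<close>; this scaling avoids a division. Expanding
    \<open>ip z z\<close> gives the inequality, since the result is nonnegative.\<close>
  define z where "z = scale (of_real b) x - scale a y"
  have yx: "ip y x = conj a" unfolding a_def by (rule ip_commute)
  have "(of_real ((norm z)\<^sup>2) :: 'k) = ip z z" by (simp add: ip_self)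
  also have "\<dots> = of_real b * of_real b * of_real ((norm x)\<^sup>2) - of_real b * (a * conj a)
      - of_real b * (a * conj a) + (a * conj a) * of_real b"
    unfolding z_def
    by (simp add: ip_diff_left ip_diff_right ip_scale_left ip_scale_right yx ip_self[of x]
        ip_self[of y] algebra_simps flip: a_def b_def del: of_real_power)
  also have "\<dots> = of_real (b * (b * (norm x)\<^sup>2 - (norm a)\<^sup>2))"
    by (simp add: mult_conj_of_real algebra_simps)
  finally have "b * (b * (norm x)\<^sup>2 - (norm a)\<^sup>2) = (norm z)\<^sup>2"
    by (metis of_real_eq_iff)
  then have "0 \<le> b * (b * (norm x)\<^sup>2 - (norm a)\<^sup>2)" by simp
  moreover have "b > 0" using False by (simp add: b_def)
  ultimately have "(norm a)\<^sup>2 \<le> (norm x * norm y)\<^sup>2"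
    by (simp add: zero_le_mult_iff b_def power_mult_distrib mult.commute)
  then show ?thesis unfolding a_def by (rule power2_le_imp_le) simp
qed simp

text \<open>Synthesis is adjoint to analysis: pairing the synthesised vector \<open>h\<close> with
  itself produces the analysis coefficients of \<open>h\<close>, and Cauchy-Schwarz for finite sums
  leaves one factor \<open>norm h\<close> to cancel.\<close>

lemma norm_synthesis_le:
  assumes "\<And>f. L2_set (\<lambda>i. norm (ip f (g i))) F \<le> K * norm f" and "0 \<le> K"
  shows "norm (\<Sum>i\<in>F. scale (c i) (g i)) \<le> K * L2_set (\<lambda>i. norm (c i)) F"
proof -
  define h where "h = (\<Sum>i\<in>F. scale (c i) (g i))"
  have "(norm h)\<^sup>2 = norm (ip h h)" by (simp add: ip_self del: of_real_power)
  \<comment> \<open>Only the second \<open>h\<close> is expanded, so that the coefficients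
    \<open>ip h (g i)\<close> remain.\<close>
  also have "ip h h = (\<Sum>i\<in>F. conj (c i) * ip h (g i))"
    by (subst (2) h_def) (simp add: ip_sum_right ip_scale_right)
  also have "norm \<dots> \<le> (\<Sum>i\<in>F. \<bar>norm (c i)\<bar> * \<bar>norm (ip h (g i))\<bar>)"
    by (rule sum_norm_le) (simp add: norm_mult)
  also have "\<dots> \<le> L2_set (\<lambda>i. norm (c i)) F * L2_set (\<lambda>i. norm (ip h (g i))) F"
    by (rule L2_set_mult_ineq)
  also have "\<dots> \<le> L2_set (\<lambda>i. norm (c i)) F * (K * norm h)"
    by (intro mult_left_mono assms L2_set_nonneg)
  finally have "norm h * norm h \<le> (K * L2_set (\<lambda>i. norm (c i)) F) * norm h"
    by (simp add: power2_eq_square mult_ac)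
  moreover have "0 \<le> K * L2_set (\<lambda>i. norm (c i)) F" by (simp add: assms(2) L2_set_nonneg)
  ultimately show ?thesis
    unfolding h_def[symmetric] by (cases "h = 0") auto
qed

lemma L2_analysis_le:
  assumes "\<And>c. norm (\<Sum>i\<in>F. scale (c i) (g i)) \<le> K * L2_set (\<lambda>i. norm (c i)) F"
    and "0 \<le> K"
  shows "L2_set (\<lambda>i. norm (ip f (g i))) F \<le> K * norm f"
proof -
  define h where "h = (\<Sum>i\<in>F. scale (ip f (g i)) (g i))"
  define S where "S = L2_set (\<lambda>i. norm (ip f (g i))) F"
  have S: "S \<ge> 0" by (simp add: S_def L2_set_nonneg)
  have "ip f h = (\<Sum>i\<in>F. ip f (g i) * conj (ip f (g i)))"
    by (simp add: h_def ip_sum_right ip_scale_right mult.commute)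
  also have "\<dots> = of_real (S\<^sup>2)"
    by (simp add: mult_conj_of_real S_def L2_set_def sum_nonneg)
  finally have "S\<^sup>2 = norm (ip f h)" by (simp del: of_real_power)
  also have "\<dots> \<le> norm f * norm h" by (rule ip_Cauchy_Schwarz)
  also have "\<dots> \<le> norm f * (K * S)"
    unfolding h_def S_def by (intro mult_left_mono assms) simp
  finally have "S * S \<le> (K * norm f) * S" by (simp add: power2_eq_square mult_ac)
  with S assms(2) have "S \<le> K * norm f" by (cases "S = 0") auto
  then show ?thesis by (simp add: S_def)
qed

end

lemma L2_set_le_sqrt_infsum:
  assumes "finite F" "F \<subseteq> I" "(\<lambda>i. (g i)\<^sup>2) summable_on I"
  shows "L2_set g F \<le> sqrt (\<Sum>\<^sub>\<infinity>i\<in>I. (g i)\<^sup>2)"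
  unfolding L2_set_def by (intro real_sqrt_le_mono finite_sum_le_infsum assms) auto

lemma L2_set_le_frame_bound:
  assumes "frame_with_bounds ip I \<phi> A B" "finite F" "F \<subseteq> I"
  shows "L2_set (\<lambda>i. norm (ip f (\<phi> i))) F \<le> sqrt B * norm f"
proof -
  have "L2_set (\<lambda>i. norm (ip f (\<phi> i))) F \<le> sqrt (\<Sum>\<^sub>\<infinity>i\<in>I. (norm (ip f (\<phi> i)))\<^sup>2)"
    using assms by (intro L2_set_le_sqrt_infsum) (auto simp: frame_with_bounds_def)
  also have "\<dots> \<le> sqrt (B * (norm f)\<^sup>2)"
    using assms(1) by (auto simp: frame_with_bounds_def)
  finally show ?thesis by (simp add: real_sqrt_mult)
qed

theorem theorem4p1:
  fixes scale :: "'k::real_or_complex \<Rightarrow> 'a::banach \<Rightarrow> 'a"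
    and ip :: "'a \<Rightarrow> 'a \<Rightarrow> 'k"
    and I :: "'i set"
    and \<phi> \<psi> :: "'i \<Rightarrow> 'a"
    and A\<^sub>\<phi> B\<^sub>\<phi> A\<^sub>\<psi> B\<^sub>\<psi> lam\<^sub>1 lam\<^sub>2 \<mu> :: real
  assumes "hilbert_space scale ip"
    and "separable_space (euclidean :: 'a topology)"
    and "countable I"
    and "frame_with_bounds ip I \<phi> A\<^sub>\<phi> B\<^sub>\<phi>"
    and "frame_with_bounds ip I \<psi> A\<^sub>\<psi> B\<^sub>\<psi>"
    and "0 < lam\<^sub>1" and "0 < lam\<^sub>2" and "0 < \<mu>"
    and "\<And>c. c \<in> ell2 I \<Longrightarrow>
           norm (\<Sum>\<^sub>\<infinity>i\<in>I. scale (c i) (\<phi> i - \<psi> i))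
             \<le> lam\<^sub>1 * norm (\<Sum>\<^sub>\<infinity>i\<in>I. scale (c i) (\<phi> i))
               + lam\<^sub>2 * norm (\<Sum>\<^sub>\<infinity>i\<in>I. scale (c i) (\<psi> i))
               + \<mu> * sqrt (\<Sum>\<^sub>\<infinity>i\<in>I. (norm (c i))\<^sup>2)"
    and "lam\<^sub>1 * sqrt B\<^sub>\<phi> + lam\<^sub>2 * sqrt B\<^sub>\<psi> + \<mu> < sqrt A\<^sub>\<phi>"
  shows "woven ip I \<phi> \<psi>"
proof -
  interpret hilbert_space scale ip by fact
  note fr = assms(4) and fr' = assms(5) and pert = assms(9) and small = assms(10)
  define D where "D = lam\<^sub>1 * sqrt B\<^sub>\<phi> + lam\<^sub>2 * sqrt B\<^sub>\<psi> + \<mu>"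
  have A: "0 < A\<^sub>\<phi>" "A\<^sub>\<phi> \<le> B\<^sub>\<phi>" and B: "0 < B\<^sub>\<phi>" "0 < B\<^sub>\<psi>"
    using fr fr' by (auto simp: frame_with_bounds_def)
  have sm: "(\<lambda>i. (norm (ip f (\<phi> i)))\<^sup>2) summable_on I" "(\<lambda>i. (norm (ip f (\<psi> i)))\<^sup>2) summable_on I"
    and low: "A\<^sub>\<phi> * (norm f)\<^sup>2 \<le> (\<Sum>\<^sub>\<infinity>i\<in>I. (norm (ip f (\<phi> i)))\<^sup>2)"
    and up: "(\<Sum>\<^sub>\<infinity>i\<in>I. (norm (ip f (\<phi> i)))\<^sup>2) \<le> B\<^sub>\<phi> * (norm f)\<^sup>2"
      "(\<Sum>\<^sub>\<infinity>i\<in>I. (norm (ip f (\<psi> i)))\<^sup>2) \<le> B\<^sub>\<psi> * (norm f)\<^sup>2" for f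
    using fr fr' by (auto simp: frame_with_bounds_def)
  have D: "0 \<le> D" "D < sqrt A\<^sub>\<phi>"
    using assms(6-8) B small by (auto simp: D_def)
  have synth: "norm (\<Sum>i\<in>F. scale (c i) (\<phi> i - \<psi> i)) \<le> D * L2_set (\<lambda>i. norm (c i)) F"
    if F: "finite F" "F \<subseteq> I" for c F
  proof -
    \<comment> \<open>Extension by zero lies in \<open>ell2 I\<close> and turns every infinite sum
      in the hypothesis into a finite one, so the default value 0 of \<open>infsum\<close> for
      divergent sums never enters.\<close>
    define c' where "c' = (\<lambda>i. if i \<in> F then c i else 0)"
    have restrict: "(\<Sum>\<^sub>\<infinity>i\<in>I. scale (c' i) (g i)) = (\<Sum>i\<in>F. scale (c i) (g i))" for g
    proof -
      have "(\<Sum>\<^sub>\<infinity>i\<in>I. scale (c' i) (g i)) = (\<Sum>\<^sub>\<infinity>i\<in>F. scale (c i) (g i))"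
        using F by (intro infsum_cong_neutral) (auto simp: c'_def)
      with F show ?thesis by simp
    qed
    have restrict2: "(\<Sum>\<^sub>\<infinity>i\<in>I. (norm (c' i))\<^sup>2) = (\<Sum>i\<in>F. (norm (c i))\<^sup>2)"
    proof -
      have "(\<Sum>\<^sub>\<infinity>i\<in>I. (norm (c' i))\<^sup>2) = (\<Sum>\<^sub>\<infinity>i\<in>F. (norm (c i))\<^sup>2)"
        using F by (intro infsum_cong_neutral) (auto simp: c'_def)
      with F show ?thesis by simp
    qed
    have "(\<lambda>i. (norm (c' i))\<^sup>2) summable_on I \<longleftrightarrow> (\<lambda>i. (norm (c i))\<^sup>2) summable_on F"
      using F by (intro summable_on_cong_neutral) (auto simp: c'_def)
    with F have "c' \<in> ell2 I" by (simp add: ell2_def)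
    from pert[OF this] have "norm (\<Sum>i\<in>F. scale (c i) (\<phi> i - \<psi> i))
        \<le> lam\<^sub>1 * norm (\<Sum>i\<in>F. scale (c i) (\<phi> i)) + lam\<^sub>2 * norm (\<Sum>i\<in>F. scale (c i) (\<psi> i))
          + \<mu> * L2_set (\<lambda>i. norm (c i)) F"
      by (simp add: restrict restrict2 L2_set_def)
    \<comment> \<open>By duality the upper frame bounds control the synthesis operators by
      \<open>sqrt B\<^sub>\<phi>\<close> and \<open>sqrt B\<^sub>\<psi>\<close>; collecting the
      factors gives \<open>D\<close>.\<close>
    also have "\<dots> \<le> lam\<^sub>1 * (sqrt B\<^sub>\<phi> * L2_set (\<lambda>i. norm (c i)) F)
        + lam\<^sub>2 * (sqrt B\<^sub>\<psi> * L2_set (\<lambda>i. norm (c i)) F) + \<mu> * L2_set (\<lambda>i. norm (c i)) F"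
      using assms(6-8) B F
      by (intro add_mono mult_left_mono norm_synthesis_le L2_set_le_frame_bound[OF fr]
          L2_set_le_frame_bound[OF fr']) auto
    finally show ?thesis by (simp add: D_def algebra_simps)
  qed
  have anal: "L2_set (\<lambda>i. norm (ip f (\<phi> i - \<psi> i))) F \<le> D * norm f"
    if "finite F" "F \<subseteq> I" for f F
    using that D by (intro L2_analysis_le synth) auto
  \<comment> \<open>Each index contributes one term of one of the two frames, hence the sum of their
    upper bounds serves as upper bound.\<close>
  have "frame_with_bounds ip I (\<lambda>i. if i \<in> J then \<phi> i else \<psi> i) ((sqrt A\<^sub>\<phi> - D)\<^sup>2) (B\<^sub>\<phi> + B\<^sub>\<psi>)"
    for J
    unfolding frame_with_bounds_def
  proof (intro conjI allI)
    show "0 < (sqrt A\<^sub>\<phi> - D)\<^sup>2" using D by simp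
    have "(sqrt A\<^sub>\<phi> - D)\<^sup>2 \<le> (sqrt A\<^sub>\<phi>)\<^sup>2" using D by (intro power_mono) auto
    then show "(sqrt A\<^sub>\<phi> - D)\<^sup>2 \<le> B\<^sub>\<phi> + B\<^sub>\<psi>" using A B by simp
    fix f
    let ?w = "\<lambda>i. norm (ip f (if i \<in> J then \<phi> i else \<psi> i))"
    let ?s = "\<lambda>i. (norm (ip f (\<phi> i)))\<^sup>2 + (norm (ip f (\<psi> i)))\<^sup>2"
    have ss: "?s summable_on I" by (intro summable_on_add sm)
    then show sw: "(\<lambda>i. (?w i)\<^sup>2) summable_on I"
      by (rule summable_on_comparison_test) auto
    have "(\<Sum>\<^sub>\<infinity>i\<in>I. (?w i)\<^sup>2) \<le> infsum ?s I"
      by (intro infsum_mono sw ss) auto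
    also have "\<dots> \<le> (B\<^sub>\<phi> + B\<^sub>\<psi>) * (norm f)\<^sup>2"
      using up[of f] by (simp add: infsum_add sm distrib_right)
    finally show "(\<Sum>\<^sub>\<infinity>i\<in>I. (?w i)\<^sup>2) \<le> (B\<^sub>\<phi> + B\<^sub>\<psi>) * (norm f)\<^sup>2" .
    define W where "W = (\<Sum>\<^sub>\<infinity>i\<in>I. (?w i)\<^sup>2)"
    have W: "W \<ge> 0" unfolding W_def by (intro infsum_nonneg) auto
    have "(\<Sum>i\<in>F. (norm (ip f (\<phi> i)))\<^sup>2) \<le> (sqrt W + D * norm f)\<^sup>2"
      if F: "finite F" "F \<subseteq> I" for F
    proof -
      \<comment> \<open>For \<open>i \<in> J\<close> the added term is merely nonnegative; otherwise
        this is the triangle inequality for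
        \<open>\<phi> i = \<psi> i + (\<phi> i - \<psi> i)\<close>.\<close>
      have "L2_set (\<lambda>i. norm (ip f (\<phi> i))) F \<le> L2_set (\<lambda>i. ?w i + norm (ip f (\<phi> i - \<psi> i))) F"
        by (intro L2_set_mono)
          (auto simp: ip_diff_right intro: norm_triangle_sub)
      also have "\<dots> \<le> L2_set ?w F + L2_set (\<lambda>i. norm (ip f (\<phi> i - \<psi> i))) F"
        by (rule L2_set_triangle_ineq)
      also have "\<dots> \<le> sqrt W + D * norm f"
        unfolding W_def using F sw by (intro add_mono anal L2_set_le_sqrt_infsum) auto
      finally show ?thesis
        unfolding L2_set_def by (rule sqrt_le_D)
    qed
    \<comment> \<open>The bound does not depend on \<open>F\<close>, so it passes to the supremum
      over finite subsets.\<close>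
    then have "(\<Sum>\<^sub>\<infinity>i\<in>I. (norm (ip f (\<phi> i)))\<^sup>2) \<le> (sqrt W + D * norm f)\<^sup>2"
      by (intro infsum_le_finite_sums sm)
    then have "(sqrt A\<^sub>\<phi> * norm f)\<^sup>2 \<le> (sqrt W + D * norm f)\<^sup>2"
      using low[of f] A by (simp add: power_mult_distrib)
    then have "sqrt A\<^sub>\<phi> * norm f \<le> sqrt W + D * norm f"
      by (rule power2_le_imp_le) (simp add: D W)
    then have "(sqrt A\<^sub>\<phi> - D) * norm f \<le> sqrt W" by (simp add: left_diff_distrib)
    \<comment> \<open>Squaring preserves the order because \<open>D < sqrt A\<^sub>\<phi>\<close>
      makes the left side nonnegative.\<close>
    then have "((sqrt A\<^sub>\<phi> - D) * norm f)\<^sup>2 \<le> (sqrt W)\<^sup>2" using D by (intro power_mono) auto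
    then show "(sqrt A\<^sub>\<phi> - D)\<^sup>2 * (norm f)\<^sup>2 \<le> (\<Sum>\<^sub>\<infinity>i\<in>I. (?w i)\<^sup>2)"
      using W by (simp add: power_mult_distrib flip: W_def)
  qed
  \<comment> \<open>The constants are the same for every \<open>J\<close>, so their order can be
    read off from any single instance.\<close>
  moreover have "0 < (sqrt A\<^sub>\<phi> - D)\<^sup>2" "(sqrt A\<^sub>\<phi> - D)\<^sup>2 \<le> B\<^sub>\<phi> + B\<^sub>\<psi>"
    using calculation unfolding frame_with_bounds_def by blast+
  ultimately show ?thesis
    unfolding woven_def by blast
qed

end
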